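(* Let $X$ be a complex Banach space and let $A,B\in\mathcal{B}(X)^D$ be $\{A,B\}$-weakly commutative. Then the following are equivalent: (i) $A+B\in\mathcal{B}(X)^D$; (ii) $AA^D(A+B)BB^D\in\mathcal{B}(X)^D$; (iii) $AA^D(A+B)\in\mathcal{B}(X)^D$; (iv) $(A+B)BB^D\in\mathcal{B}(X)^D$.
   Context: $\mathcal{B}(X)$ is the algebra of bounded linear operators on the complex Banach space $X$, $I$ the identity operator. $A\in\mathcal{B}(X)$ is Drazin invertible if there is $A^D\in\mathcal{B}(X)$ (the Drazin inverse of $A$, unique when it exists) with $AA^D=A^DA$, $A^DAA^D=A^D$ and $A(I-AA^D)$ nilpotent; $\mathcal{B}(X)^D$ is the set of Drazin invertible operators. Operators $A,B\in\mathcal{B}(X)$ are $A$-weakly commutative if there is $C_1\in\mathcal{B}(X)$ with $AB=C_1A$ and $BA=AC_1$; they are $B$-weakly commutative if there is $C_2\in\mathcal{B}(X)$ with $AB=BC_2$ and $BA=C_2B$; they are $\{A,B\}$-weakly commutative if they are both $A$-weakly commutative and $B$-weakly commutative. *)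

theory Defs
  imports "HOL-Analysis.Analysis"
begin

(* The library only has real Banach spaces.  A complex Banach space is a real one with a
   complex scalar multiplication that extends the real one and is compatible with the norm. *)
class complex_banach = banach +
  fixes scaleC :: "complex \<Rightarrow> 'a \<Rightarrow> 'a"  (infixr "*\<^sub>C" 75)
  assumes scaleC_add_right: "c *\<^sub>C (x + y) = c *\<^sub>C x + c *\<^sub>C y"
    and scaleC_add_left: "(c + d) *\<^sub>C x = c *\<^sub>C x + d *\<^sub>C x"
    and scaleC_scaleC: "c *\<^sub>C d *\<^sub>C x = (c * d) *\<^sub>C x"
    and scaleC_of_real: "complex_of_real r *\<^sub>C x = r *\<^sub>R x"
    and norm_scaleC: "norm (c *\<^sub>C x) = cmod c * norm x"

(* The algebra B(X): a bounded operator in the sense of the library type is only real-linear. *)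
definition bounded_ops :: "('a::complex_banach \<Rightarrow>\<^sub>L 'a) set"
  where "bounded_ops = {A :: 'a \<Rightarrow>\<^sub>L 'a. \<forall>c x. A (c *\<^sub>C x) = c *\<^sub>C A x}"

primrec op_power :: "('a::real_normed_vector \<Rightarrow>\<^sub>L 'a) \<Rightarrow> nat \<Rightarrow> ('a \<Rightarrow>\<^sub>L 'a)"
  where
    "op_power T 0 = id_blinfun"
  | "op_power T (Suc n) = T o\<^sub>L op_power T n"

definition nilpotent_op :: "('a::real_normed_vector \<Rightarrow>\<^sub>L 'a) \<Rightarrow> bool"
  where "nilpotent_op T \<longleftrightarrow> (\<exists>n. op_power T n = 0)"

definition is_drazin_inverse ::
    "('a::complex_banach \<Rightarrow>\<^sub>L 'a) \<Rightarrow> ('a \<Rightarrow>\<^sub>L 'a) \<Rightarrow> bool"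
  where "is_drazin_inverse A D \<longleftrightarrow>
    D \<in> bounded_ops \<and>
    A o\<^sub>L D = D o\<^sub>L A \<and>
    D o\<^sub>L A o\<^sub>L D = D \<and>
    nilpotent_op (A o\<^sub>L (id_blinfun - (A o\<^sub>L D)))"

definition drazin_invertible_ops :: "('a::complex_banach \<Rightarrow>\<^sub>L 'a) set"
  where "drazin_invertible_ops = {A \<in> bounded_ops. \<exists>D. is_drazin_inverse A D}"

definition drazin_inverse ::
    "('a::complex_banach \<Rightarrow>\<^sub>L 'a) \<Rightarrow> ('a \<Rightarrow>\<^sub>L 'a)"  ("(_\<^sup>D)" [1000] 999)
  where "A\<^sup>D = (THE D. is_drazin_inverse A D)"

lemma blinfun_eq_iff: "F = G \<longleftrightarrow> (\<forall>x. blinfun_apply F x = blinfun_apply G x)"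
  by (auto intro: blinfun_eqI)

lemma op_power_commute: "op_power T n o\<^sub>L T = T o\<^sub>L op_power T n"
  by (induction n) (simp_all add: blinfun_eq_iff)

lemma is_drazin_inverse_absorb:
  assumes "is_drazin_inverse A D" and "is_drazin_inverse A E"
  shows "A o\<^sub>L D o\<^sub>L (A o\<^sub>L E) = A o\<^sub>L E" and "A o\<^sub>L D o\<^sub>L (A o\<^sub>L E) = A o\<^sub>L D"
proof -
  have D: "A (D x) = D (A x)" "D (D (A x)) = D x" for x
    using assms(1) unfolding is_drazin_inverse_def blinfun_eq_iff by (simp, metis blinfun_apply_blinfun_compose)
  have E: "A (E x) = E (A x)" "E (E (A x)) = E x" for x
    using assms(2) unfolding is_drazin_inverse_def blinfun_eq_iff by (simp, metis blinfun_apply_blinfun_compose)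
  define S T where "S = A o\<^sub>L (id_blinfun - (A o\<^sub>L D))" and "T = A o\<^sub>L (id_blinfun - (A o\<^sub>L E))"
  define X Y where "X = (id_blinfun - (A o\<^sub>L D)) o\<^sub>L (A o\<^sub>L E)"
    and "Y = A o\<^sub>L D o\<^sub>L (id_blinfun - (A o\<^sub>L E))"
  have X: "X x = S (X (E x))" for x
  proof -
    have S: "S (A (D y)) = 0" for y
      by (simp add: S_def blinfun.bilinear_simps D)
    have "X (E x) = E x - A (D (E x))"
      by (simp add: X_def blinfun.bilinear_simps E)
    then have "S (X (E x)) = S (E x)"
      by (simp add: blinfun.diff_right S)
    also have "\<dots> = X x"
      by (simp add: X_def S_def blinfun.bilinear_simps D(1))
    finally show ?thesis by simp
  qed
  have Y: "Y x = D (Y (T x))" for x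
  proof -
    have "A (E (T x)) = 0"
      by (simp add: T_def blinfun.bilinear_simps E)
    then have "D (Y (T x)) = D (T x)"
      by (simp add: Y_def blinfun.bilinear_simps D)
    also have "\<dots> = Y x"
      by (simp add: Y_def T_def blinfun.bilinear_simps D(1))
    finally show ?thesis by simp
  qed
  have "\<exists>Z. \<forall>x. X x = op_power S n (X (blinfun_apply Z x))" for n
  proof (induction n)
    case 0
    show ?case by (rule exI[of _ id_blinfun]) simp
  next
    case (Suc n)
    then obtain Z where Z: "X x = op_power S n (X (blinfun_apply Z x))" for x by blast
    have "X x = op_power S (Suc n) (X ((E o\<^sub>L Z) x))" for x
      using Z[of x] X[of "Z x"] op_power_commute[of S n]
      by (simp add: blinfun_eq_iff)
    then show ?case by blast
  qed
  moreover have "\<exists>Z. \<forall>x. Y x = blinfun_apply Z (Y (op_power T n x))" for n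
  proof (induction n)
    case 0
    show ?case by (rule exI[of _ id_blinfun]) simp
  next
    case (Suc n)
    then obtain Z where Z: "Y x = blinfun_apply Z (Y (op_power T n x))" for x by blast
    have "Y x = (Z o\<^sub>L D) (Y (op_power T (Suc n) x))" for x
      using Z[of x] Y[of "op_power T n x"] by simp
    then show ?case by blast
  qed
  moreover obtain m n where "op_power S m = 0" "op_power T n = 0"
    using assms unfolding is_drazin_inverse_def nilpotent_op_def S_def T_def by blast
  ultimately have "X x = 0" "Y x = 0" for x
    by (metis blinfun.zero_left, metis blinfun.zero_left blinfun.zero_right)
  then show "A o\<^sub>L D o\<^sub>L (A o\<^sub>L E) = A o\<^sub>L E" "A o\<^sub>L D o\<^sub>L (A o\<^sub>L E) = A o\<^sub>L D"
    by (simp_all add: X_def Y_def blinfun_eq_iff blinfun.bilinear_simps)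
qed

lemma is_drazin_inverse_unique:
  assumes "is_drazin_inverse A D" and "is_drazin_inverse A E"
  shows "D = E"
proof -
  have "A o\<^sub>L D = A o\<^sub>L E"
    using is_drazin_inverse_absorb[OF assms] by simp
  then show ?thesis
    using assms unfolding is_drazin_inverse_def blinfun_eq_iff
    by (metis blinfun_apply_blinfun_compose)
qed

lemma is_drazin_inverse_drazin_inverse:
  assumes "A \<in> drazin_invertible_ops"
  shows "is_drazin_inverse A (A\<^sup>D)"
  using assms is_drazin_inverse_unique unfolding drazin_inverse_def drazin_invertible_ops_def
  by (auto intro: theI2)

(* "A B are A-weakly commutative"; B-weak commutativity is the same condition with the roles
   of A and B exchanged, i.e. first_weakly_commutative B A. *)
definition first_weakly_commutative ::
    "('a::complex_banach \<Rightarrow>\<^sub>L 'a) \<Rightarrow> ('a \<Rightarrow>\<^sub>L 'a) \<Rightarrow> bool"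
  where "first_weakly_commutative A B \<longleftrightarrow>
    (\<exists>C\<in>bounded_ops. A o\<^sub>L B = C o\<^sub>L A \<and> B o\<^sub>L A = A o\<^sub>L C)"

definition weakly_commutative ::
    "('a::complex_banach \<Rightarrow>\<^sub>L 'a) \<Rightarrow> ('a \<Rightarrow>\<^sub>L 'a) \<Rightarrow> bool"
  where "weakly_commutative A B \<longleftrightarrow>
    first_weakly_commutative A B \<and> first_weakly_commutative B A"

end

theory Submission
  imports Defs
begin

text \<open>
The argument takes place in an arbitrary ring.  Let \<open>ab = ca\<close> and \<open>ba = ac\<close>.  Then
\<open>a\<^sup>2b = aca = ba\<^sup>2\<close>: although \<open>a\<close> and \<open>b\<close> need not commute, \<open>a\<^sup>2\<close> commutes with \<open>b\<close>, and
likewise with \<open>c\<close>.  Since the Drazin inverse lies in the bicommutant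
(\<open>drazin_inv_bicommutant\<close>) and \<open>aa\<^sup>D = a\<^sup>2(a\<^sup>D)\<^sup>2\<close>, the idempotent \<open>p = aa\<^sup>D\<close> commutes with
\<open>b\<close>.  By symmetry \<open>b\<^sup>2\<close> and \<open>bb\<^sup>D\<close> commute with \<open>a\<close>.  So the idempotents split the ring,
and what happens on each corner can be studied separately (\<open>drazin_split\<close>).

The heart is \<open>drazin_add_iff_idempotent\<close>: on the corner of \<open>q = 1 - p\<close>, where \<open>a\<close> is nilpotent,
the sum \<open>a + b\<close> is always Drazin invertible, so that only its part on the corner of \<open>p\<close>
matters.  An element is Drazin invertible iff its square is (\<open>drazin_square_iff\<close>), and in
\<open>(a + b)\<^sup>2 = b\<^sup>2 + (a\<^sup>2 + ab + ba)\<close> all four terms commute with each other; for instance \<open>(ab)(ba) = a\<^sup>2b\<^sup>2 = (ba)(ab)\<close>.  Moreover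
\<open>(ab)\<^sup>2 = a(ba)b = a\<^sup>2cb\<close>, where \<open>a\<^sup>2\<close> commutes with \<open>cb\<close>, so that \<open>ab\<close>, and with it \<open>ba\<close>,
inherits nilpotency from \<open>a\<close>.  The square is therefore, on the corner of \<open>q\<close>, the Drazin
invertible element \<open>b\<^sup>2\<close> perturbed by a nilpotent that commutes with it
(\<open>drazin_add_nilpotent\<close>).

Applied to \<open>(a, b)\<close> and to \<open>(b, a)\<close> this gives the two equivalences with one idempotent factor;
applied to \<open>(pb, pa)\<close> and the idempotent \<open>bb\<^sup>D\<close> it gives the one with both factors.  The theorem on
operators follows because the bounded complex-linear operators form a ring.
\<close>


section \<open>Nilpotent elements of a ring\<close>

text \<open>The rings carry the sort of a ring with a multiplicative monoid instead of \<open>ring_1\<close>, which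
demands \<open>0 \<noteq> 1\<close> and so would exclude the operators on the zero space.\<close>

definition nilpotent :: "'r::{ring, monoid_mult} \<Rightarrow> bool"
  where "nilpotent a \<longleftrightarrow> (\<exists>n. a ^ n = 0)"

lemma power_mult_commuting:
  fixes a b :: "'r::monoid_mult"
  assumes "a * b = b * a"
  shows "(a * b) ^ n = a ^ n * b ^ n"
proof (induction n)
  case 0
  show ?case by simp
next
  case (Suc n)
  have "b * a ^ n = a ^ n * b"
    using power_commuting_commutes[OF assms] by simp
  then have "(a * b) * (a ^ n * b ^ n) = a * a ^ n * (b * b ^ n)"
    by (metis mult.assoc)
  then show ?case using Suc by simp
qed

lemma idempotent_power:
  fixes p :: "'r::monoid_mult"
  assumes "p * p = p"
  shows "p ^ Suc n = p"
  using assms by (induction n) simp_all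

lemma power_idempotent_mult:
  fixes a p :: "'r::monoid_mult"
  assumes "p * p = p" and "p * a = a * p"
  shows "(p * a) ^ Suc n = p * a ^ Suc n"
  using power_mult_commuting[OF assms(2), of "Suc n"] idempotent_power[OF assms(1), of n] by simp

lemma power_zero_mono:
  fixes a :: "'r::{ring, monoid_mult}"
  assumes "a ^ m = 0" and "m \<le> n"
  shows "a ^ n = 0"
  using assms by (metis le_Suc_ex mult_zero_left power_add)

lemma nilpotent_add:
  fixes a b :: "'r::{ring, monoid_mult}"
  assumes "nilpotent a" and "nilpotent b" and ab: "a * b = b * a"
  shows "nilpotent (a + b)"
proof -
  obtain m n where mn: "a ^ m = 0" "b ^ n = 0"
    using assms unfolding nilpotent_def by blast
  \<comment> \<open>In place of the binomial theorem: multiplying out one factor \<open>a + b\<close> at a time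
    moves it into the exponents of \<open>a\<close> and \<open>b\<close>, until one of these is large enough.\<close>
  have "a ^ i * b ^ j * (a + b) ^ k = 0" if "i + j + k = m + n" for i j k
    using that
  proof (induction k arbitrary: i j)
    case 0
    then have "m \<le> i \<or> n \<le> j" by auto
    then show ?case using mn power_zero_mono by (metis mult_zero_left mult_zero_right)
  next
    case (Suc k)
    have "b ^ j * a = a * b ^ j"
      using power_commuting_commutes[of b a j] ab by simp
    then have "a ^ i * b ^ j * (a + b) = a ^ Suc i * b ^ j + a ^ i * b ^ Suc j"
      by (simp add: distrib_left mult.assoc power_commutes) (metis mult.assoc power_commutes)
    then have "a ^ i * b ^ j * (a + b) ^ Suc k
        = a ^ Suc i * b ^ j * (a + b) ^ k + a ^ i * b ^ Suc j * (a + b) ^ k"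
      by (metis distrib_right mult.assoc power_Suc)
    also have "\<dots> = 0"
      using Suc.IH[of "Suc i" j] Suc.IH[of i "Suc j"] Suc.prems by simp
    finally show ?case .
  qed
  from this[of 0 0 "m + n"] show ?thesis
    unfolding nilpotent_def by auto
qed

lemma nilpotent_mult:
  fixes a b :: "'r::{ring, monoid_mult}"
  assumes "nilpotent a" and "a * b = b * a"
  shows "nilpotent (a * b)"
  using assms power_mult_commuting unfolding nilpotent_def by (metis mult_zero_left)

text \<open>The inverse is the Neumann series, here a finite sum.  Being a polynomial in \<open>x\<close>, it commutes with
everything that commutes with \<open>x\<close>.\<close>

lemma one_plus_nilpotent_invertible:
  fixes x :: "'r::{ring, monoid_mult}"
  assumes "nilpotent x"
  obtains u where "(1 + x) * u = 1" and "\<And>y. x * y = y * x \<Longrightarrow> u * y = y * u"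
proof -
  obtain n where n: "x ^ n = 0"
    using assms unfolding nilpotent_def by blast
  define u where "u m = (\<Sum>k<m. (- x) ^ k)" for m
  have "(1 + x) * u m = 1 - (- x) ^ m" for m
    by (induction m) (simp_all add: u_def algebra_simps)
  moreover have "(- x) ^ m = x ^ m \<or> (- x) ^ m = - (x ^ m)" for m
    by (induction m) auto
  ultimately have "(1 + x) * u n = 1"
    using n by (metis diff_zero neg_equal_0_iff_equal)
  moreover have "u m * y = y * u m" if "x * y = y * x" for m y
  proof -
    have "(- x) ^ k * y = y * (- x) ^ k" for k
      using power_commuting_commutes[of "- x" y k] that by simp
    then show ?thesis
      unfolding u_def by (simp add: sum_distrib_left sum_distrib_right)
  qed
  ultimately show ?thesis using that by blast
qed


section \<open>Drazin invertibility in a ring\<close>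

definition drazin_inv :: "'r::{ring, monoid_mult} \<Rightarrow> 'r \<Rightarrow> bool"
  where "drazin_inv a d \<longleftrightarrow>
    a * d = d * a \<and> d * a * d = d \<and> nilpotent (a * (1 - a * d))"

definition drazin :: "'r::{ring, monoid_mult} \<Rightarrow> bool"
  where "drazin a \<longleftrightarrow> (\<exists>d. drazin_inv a d)"

lemma drazin_inv_idempotent:
  assumes "drazin_inv a d"
  shows "(a * d) * (a * d) = a * d" and "a * (a * d) = (a * d) * a"
  using assms unfolding drazin_inv_def by (metis mult.assoc)+

text \<open>Nilpotency of \<open>a(1 - ad)\<close> means that \<open>1 - ad\<close> kills high powers of \<open>a\<close>, on which \<open>d\<close> thus
cancels one factor \<open>a\<close>.  The exponents are successors because then the powers of the idempotent
collapse.\<close>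

lemma drazin_inv_power:
  assumes "drazin_inv a d"
  obtains n where "a ^ Suc n * (1 - a * d) = 0"
    and "\<And>m. n \<le> m \<Longrightarrow> a ^ Suc (Suc m) * d = a ^ Suc m"
proof -
  let ?p = "1 - a * d"
  obtain n where "(a * ?p) ^ n = 0"
    using assms unfolding drazin_inv_def nilpotent_def by blast
  then have "(a * ?p) ^ Suc n = 0" by simp
  moreover have "?p * ?p = ?p" and "a * ?p = ?p * a"
    using drazin_inv_idempotent[OF assms] by (simp_all add: algebra_simps)
  ultimately have n: "a ^ Suc n * ?p = 0"
    by (metis idempotent_power power_mult_commuting)
  have "a ^ Suc (Suc m) * d = a ^ Suc m" if "n \<le> m" for m
  proof -
    have "a ^ Suc m = a ^ (m - n) * a ^ Suc n"
      using that by (metis add_Suc_right le_add_diff_inverse2 power_add)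
    then have "a ^ Suc m * ?p = 0"
      using n by (simp add: mult.assoc)
    moreover have "a ^ Suc (Suc m) * d = a ^ Suc m * (a * d)"
      by (metis mult.assoc power_Suc2)
    ultimately show ?thesis
      by (simp add: right_diff_distrib)
  qed
  with n show ?thesis using that by blast
qed

text \<open>Strong \<open>\<pi>\<close>-regularity suffices for Drazin invertibility: an element \<open>d\<close> that cancels one factor on
high powers of \<open>a\<close> may be wrong elsewhere, but \<open>a\<^sup>nd\<^sup>n\<^sup>+\<^sup>1\<close> discards this part and is the Drazin
inverse.\<close>

lemma drazinI:
  fixes a d :: "'r::{ring, monoid_mult}"
  assumes ad: "a * d = d * a" and n: "a ^ Suc n * d = a ^ n"
  shows "drazin a"
proof -
  have reduce: "a ^ (k + n) * d ^ k = a ^ n" for k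
  proof (induction k)
    case 0
    show ?case by simp
  next
    case (Suc k)
    have "a ^ (Suc k + n) = a ^ k * a ^ Suc n"
      by (metis add_Suc add_Suc_right power_add)
    then have "a ^ (Suc k + n) * d ^ Suc k = a ^ k * (a ^ Suc n * d) * d ^ k"
      by (simp add: mult.assoc)
    then show ?case using Suc n by (simp add: power_add)
  qed
  define x where "x = a ^ n * d ^ Suc n"
  have comm: "a ^ i * d ^ j = d ^ j * a ^ i" for i j
    using ad by (metis power_commuting_commutes)
  have ax: "a * x = a ^ Suc n * d ^ Suc n" and xa: "x * a = a ^ Suc n * d ^ Suc n"
    using comm[of 1 "Suc n"] unfolding x_def
    by (simp_all add: mult.assoc power_commutes) (metis mult.assoc power_Suc power_commutes)
  have kill: "a ^ n * (a * x) = a ^ n"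
  proof -
    have "a ^ n * (a * x) = a ^ n * a ^ Suc n * d ^ Suc n"
      unfolding ax by (rule mult.assoc[symmetric])
    also have "\<dots> = a ^ (Suc n + n) * d ^ Suc n"
      by (metis add.commute power_add)
    also have "\<dots> = a ^ n" by (rule reduce)
    finally show ?thesis .
  qed
  have "x * a * x = d ^ Suc n * (a ^ n * (a * x))"
    unfolding x_def using comm[of n "Suc n"] by (metis mult.assoc)
  then have "x * a * x = x"
    using kill comm[of n "Suc n"] by (simp add: x_def)
  moreover have "(a * (1 - a * x)) ^ Suc n = 0"
  proof -
    have idem: "(1 - a * x) * (1 - a * x) = 1 - a * x"
      using \<open>x * a * x = x\<close> by (simp add: algebra_simps)
    have "a * (a * x) = a * x * a"
      using ax xa by (metis mult.assoc)
    then have cm: "a * (1 - a * x) = (1 - a * x) * a"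
      by (simp only: left_diff_distrib right_diff_distrib mult_1_left mult_1_right)
    have "(a * (1 - a * x)) ^ Suc n = a ^ Suc n * (1 - a * x)"
      using power_mult_commuting[OF cm] idempotent_power[OF idem] by metis
    also have "\<dots> = 0"
      using kill by (simp add: right_diff_distrib mult.assoc)
    finally show ?thesis .
  qed
  ultimately have "drazin_inv a x"
    unfolding drazin_inv_def nilpotent_def using ax xa by metis
  then show ?thesis unfolding drazin_def by blast
qed

text \<open>Put \<open>e = ad\<close>.  For large \<open>n\<close>, \<open>e = d\<^sup>na\<^sup>n = a\<^sup>nd\<^sup>n\<close> while \<open>1 - e\<close> kills \<open>a\<^sup>n\<close>, and \<open>a\<^sup>n\<close> can be moved
past \<open>c\<close>; so \<open>ec(1 - e) = 0 = (1 - e)ce\<close> and \<open>c\<close> commutes with \<open>e\<close>.  On the corner of \<open>e\<close>, \<open>d\<close> is a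
true inverse of \<open>a\<close>.\<close>

lemma drazin_inv_bicommutant:
  assumes d: "drazin_inv a d" and ac: "a * c = c * a"
  shows "d * c = c * d"
proof -
  let ?e = "a * d"
  have ad: "a * d = d * a" and dad: "d * a * d = d"
    using d unfolding drazin_inv_def by auto
  obtain n where n: "a ^ Suc n * (1 - ?e) = 0"
    using drazin_inv_power[OF d] by metis
  have e: "?e = d ^ Suc n * a ^ Suc n" "?e = a ^ Suc n * d ^ Suc n"
    using idempotent_power[of ?e n] drazin_inv_idempotent[OF d]
      power_mult_commuting[OF ad] power_mult_commuting[OF ad[symmetric]] ad by metis+
  have "a * (1 - ?e) = (1 - ?e) * a"
    using drazin_inv_idempotent(2)[OF d] by (simp add: algebra_simps)
  then have n': "(1 - ?e) * a ^ Suc n = 0"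
    using n power_commuting_commutes by metis
  have can: "a ^ Suc n * c = c * a ^ Suc n"
    using power_commuting_commutes[OF ac] .
  have "?e * c * (1 - ?e) = 0"
    using n can unfolding e(1) by (metis mult.assoc mult_zero_right)
  then have ece: "?e * c = ?e * c * ?e" by (simp add: right_diff_distrib)
  have "(1 - ?e) * c * ?e = 0"
    using n' can unfolding e(2) by (metis mult.assoc mult_zero_left mult_zero_right)
  then have "c * ?e = ?e * c * ?e" by (simp add: left_diff_distrib)
  with ece have ec: "?e * c = c * ?e" by simp
  \<comment> \<open>The usual computation for inverses, with \<open>e\<close> in the role of the unit.\<close>
  have "d * c = d * (?e * c)" by (metis ad dad mult.assoc)
  also have "\<dots> = d * c * a * d" by (metis ec mult.assoc)
  also have "\<dots> = ?e * c * d" by (metis ac ad mult.assoc)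
  also have "\<dots> = c * d" by (metis ad dad ec mult.assoc)
  finally show ?thesis .
qed

lemma drazin_inv_square:
  assumes d: "drazin_inv a d"
  shows "drazin_inv (a * a) (d * d)" and "a * a * (d * d) = a * d"
proof -
  have ad: "a * d = d * a" and dad: "d * a * d = d"
    using d unfolding drazin_inv_def by auto
  show e: "a * a * (d * d) = a * d"
    using ad dad by (metis mult.assoc)
  have "(1 - a * d) * a = a * (1 - a * d)"
    using drazin_inv_idempotent(2)[OF d]
    by (simp only: left_diff_distrib right_diff_distrib mult_1_left mult_1_right)
  then have "a * (1 - a * d) * a = a * (a * (1 - a * d))"
    by (metis mult.assoc)
  then have "nilpotent (a * a * (1 - a * d))"
    using nilpotent_mult[of "a * (1 - a * d)" a] d unfolding drazin_inv_def
    by (metis mult.assoc)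
  moreover have "a * a * (d * d) = d * d * (a * a)"
    using ad by (metis mult.assoc)
  moreover have "d * d * (a * a) * (d * d) = d * d"
    using ad dad by (metis mult.assoc)
  ultimately show "drazin_inv (a * a) (d * d)"
    unfolding drazin_inv_def using e by metis
qed

text \<open>If \<open>d\<close> is the Drazin inverse of \<open>a\<^sup>2\<close>, then \<open>ad\<close> is one of \<open>a\<close>; it commutes with \<open>a\<close> because \<open>d\<close> is in
the bicommutant of \<open>a\<^sup>2\<close>.\<close>

lemma drazin_square_iff: "drazin (a * a) \<longleftrightarrow> drazin a"
proof
  assume "drazin (a * a)"
  then obtain d where d: "drazin_inv (a * a) d" unfolding drazin_def by blast
  obtain n where n: "(a * a) ^ Suc (Suc n) * d = (a * a) ^ Suc n"
    using drazin_inv_power[OF d] by blast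
  have da: "d * a = a * d"
    by (rule drazin_inv_bicommutant[OF d]) (simp add: mult.assoc)
  define m where "m = 2 * Suc n"
  have pw: "(a * a) ^ k = a ^ (2 * k)" for k
    by (simp add: power_mult power2_eq_square)
  have "a ^ Suc m * (a * d) = a ^ (2 * Suc (Suc n)) * d"
    unfolding m_def by (simp add: mult.assoc power_commutes) (metis mult.assoc power_commutes)
  also have "\<dots> = a ^ m"
    using n unfolding pw m_def by simp
  finally show "drazin a"
    using da by (intro drazinI[of a "a * d" m]) (simp_all add: mult.assoc)
next
  assume "drazin a"
  then show "drazin (a * a)" unfolding drazin_def using drazin_inv_square by blast
qed

lemma drazin_idempotent_mult:
  assumes "drazin a" and p: "p * p = p" "p * a = a * p"
  shows "drazin (p * a)"
proof -
  obtain d where d: "drazin_inv a d" using assms(1) unfolding drazin_def by blast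
  obtain n where n: "a ^ Suc (Suc n) * d = a ^ Suc n"
    using drazin_inv_power[OF d] by blast
  have dp: "d * p = p * d"
    using drazin_inv_bicommutant[OF d] p by metis
  show ?thesis
  proof (rule drazinI)
    show "p * a * d = d * (p * a)"
      using d dp unfolding drazin_inv_def by (metis mult.assoc)
    show "(p * a) ^ Suc (Suc n) * d = (p * a) ^ Suc n"
      unfolding power_idempotent_mult[OF p] mult.assoc n ..
  qed
qed

text \<open>With \<open>q = 1 - p\<close>, inverses on the two corners glue to \<open>pd\<^sub>1 + qd\<^sub>2\<close>, which commutes with \<open>a\<close>
because each \<open>d\<^sub>i\<close> does by the bicommutant property.\<close>

lemma drazin_split:
  assumes p: "p * p = p" "p * a = a * p"
  shows "drazin a \<longleftrightarrow> drazin (p * a) \<and> drazin ((1 - p) * a)"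
proof -
  define q where "q = 1 - p"
  have q: "q * q = q" "q * a = a * q" and pq: "p + q = 1"
    using p by (simp_all add: q_def algebra_simps)
  have "drazin a" if pa: "drazin (p * a)" and qa: "drazin (q * a)"
  proof -
    obtain d1 where d1: "drazin_inv (p * a) d1" using pa unfolding drazin_def by blast
    obtain d2 where d2: "drazin_inv (q * a) d2" using qa unfolding drazin_def by blast
    obtain n1 where n1: "\<And>m. n1 \<le> m \<Longrightarrow> (p * a) ^ Suc (Suc m) * d1 = (p * a) ^ Suc m"
      using drazin_inv_power[OF d1] by blast
    obtain n2 where n2: "\<And>m. n2 \<le> m \<Longrightarrow> (q * a) ^ Suc (Suc m) * d2 = (q * a) ^ Suc m"
      using drazin_inv_power[OF d2] by blast
    let ?n = "n1 + n2" and ?d = "p * d1 + q * d2"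
    have a: "d1 * a = a * d1" "d2 * a = a * d2"
      using drazin_inv_bicommutant[OF d1, of a] drazin_inv_bicommutant[OF d2, of a] p q
      by (metis mult.assoc)+
    have pw: "a ^ Suc m * p = (p * a) ^ Suc m" "a ^ Suc m * q = (q * a) ^ Suc m" for m
      unfolding power_idempotent_mult[OF p] power_idempotent_mult[OF q]
      using power_commuting_commutes p(2) q(2) by metis+
    have "a ^ Suc (Suc ?n) * ?d = a ^ Suc (Suc ?n) * p * d1 + a ^ Suc (Suc ?n) * q * d2"
      by (simp only: distrib_left mult.assoc)
    also have "\<dots> = a ^ Suc ?n * p + a ^ Suc ?n * q"
      unfolding pw using n1[of ?n] n2[of ?n] by simp
    also have "\<dots> = a ^ Suc ?n"
      using pq by (metis distrib_left mult_1_right)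
    finally have "a ^ Suc (Suc ?n) * ?d = a ^ Suc ?n" .
    moreover have "a * ?d = ?d * a"
      unfolding distrib_left distrib_right using a p q by (metis mult.assoc)
    ultimately show ?thesis by (intro drazinI)
  qed
  then show ?thesis
    using drazin_idempotent_mult p q unfolding q_def by blast
qed

text \<open>Let \<open>e = ad\<close>.  On the corner of \<open>e\<close>, \<open>a + v = a(1 + dv)\<close> is a product of two invertible elements,
as \<open>dv\<close> is nilpotent; on that of \<open>1 - e\<close> it is a sum of two commuting nilpotents.  So \<open>du\<close> with
\<open>u = (1 + dv)\<^sup>-\<^sup>1\<close> is the Drazin inverse, with the same idempotent \<open>e\<close>.\<close>

lemma drazin_add_nilpotent:
  assumes "drazin a" and v: "nilpotent v" and av: "a * v = v * a"
  shows "drazin (a + v)"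
proof -
  obtain d where d: "drazin_inv a d" using assms(1) unfolding drazin_def by blast
  define e where "e = a * d"
  have ad: "a * d = d * a" and ed: "e * d = d"
    using d unfolding drazin_inv_def e_def by (metis mult.assoc)+
  have dv: "d * v = v * d"
    using drazin_inv_bicommutant[OF d av] .
  have ea: "e * a = a * e" and ev: "e * v = v * e" and ee: "e * e = e"
    unfolding e_def using ad av dv drazin_inv_idempotent[OF d] by (metis mult.assoc)+
  have "nilpotent (d * v)"
    using nilpotent_mult[OF v] dv by metis
  then obtain u where u: "(1 + d * v) * u = 1"
    and comm: "\<And>y. d * v * y = y * (d * v) \<Longrightarrow> u * y = y * u"
    using one_plus_nilpotent_invertible by blast
  have uc: "u * a = a * u" "u * v = v * u"
    using comm ad av dv by (metis mult.assoc)+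
  have "(a + v) * (d * u) = e * u + d * v * u"
    by (simp add: distrib_right e_def mult.assoc dv flip: mult.assoc)
  also have "\<dots> = e * ((1 + d * v) * u)"
    using ed by (simp add: distrib_left distrib_right flip: mult.assoc)
  finally have y: "(a + v) * (d * u) = e"
    using u by simp
  have y': "d * u * (a + v) = (a + v) * (d * u)"
    unfolding distrib_left distrib_right using uc ad dv by (metis mult.assoc)
  have q: "(1 - e) * (1 - e) = 1 - e" "(1 - e) * (a + v) = (a + v) * (1 - e)"
    using ee ea ev by (simp_all add: algebra_simps)
  have "nilpotent (a * (1 - e) + v * (1 - e))"
  proof (rule nilpotent_add)
    show "nilpotent (a * (1 - e))"
      using d unfolding drazin_inv_def e_def by blast
    show "nilpotent (v * (1 - e))"
      using ev by (intro nilpotent_mult v) (simp add: algebra_simps)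
    have "(1 - e) * v = v * (1 - e)" "(1 - e) * a = a * (1 - e)"
      using ea ev by (simp_all add: algebra_simps)
    then show "a * (1 - e) * (v * (1 - e)) = v * (1 - e) * (a * (1 - e))"
      using av by (metis mult.assoc)
  qed
  then obtain n where "((1 - e) * (a + v)) ^ n = 0"
    unfolding q(2) nilpotent_def by (auto simp: distrib_right)
  then have "((1 - e) * (a + v)) ^ Suc n = 0" by simp
  then have "(1 - e) * (a + v) ^ Suc n = 0"
    unfolding power_idempotent_mult[OF q] .
  then have n: "(a + v) ^ Suc n * e = (a + v) ^ Suc n"
    using power_commuting_commutes[OF q(2)[symmetric], of "Suc n"]
    by (simp add: right_diff_distrib)
  have "(a + v) ^ Suc (Suc n) * (d * u) = (a + v) ^ Suc n * ((a + v) * (d * u))"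
    by (metis mult.assoc power_Suc2)
  then have "(a + v) ^ Suc (Suc n) * (d * u) = (a + v) ^ Suc n"
    using n y by simp
  then show ?thesis
    by (rule drazinI[OF y'[symmetric]])
qed


section \<open>Weakly commuting elements of a ring\<close>

text \<open>Moving a factor \<open>a\<close> past \<open>b\<close> turns \<open>b\<close> into \<open>c\<close>, and moving the second one past \<open>c\<close> turns it
back into \<open>b\<close>.\<close>

lemma weak_commute_square:
  fixes a b c :: "'r::semigroup_mult"
  assumes "a * b = c * a" and "b * a = a * c"
  shows "a * a * b = b * (a * a)" and "a * a * c = c * (a * a)"
    and "a * b * (a * b) = a * a * (c * b)"
proof -
  show 1: "a * a * b = b * (a * a)" using assms by (metis mult.assoc)
  show "a * a * c = c * (a * a)" using assms by (metis mult.assoc)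
  have "a * b * (a * b) = a * (b * a) * b" by (simp only: mult.assoc)
  also have "\<dots> = a * a * (c * b)" by (simp only: assms mult.assoc)
  finally show "a * b * (a * b) = a * a * (c * b)" .
qed

text \<open>The idempotent of \<open>a\<close> is also that of \<open>a\<^sup>2\<close>, and \<open>a\<^sup>2\<close> does commute with \<open>b\<close>.\<close>

lemma weak_commute_drazin_idempotent:
  assumes d: "drazin_inv a d" and "a * b = c * a" and "b * a = a * c"
  shows "a * d * b = b * (a * d)"
proof -
  have "d * d * b = b * (d * d)"
    using weak_commute_square(1)[OF assms(2,3)] drazin_inv_square(1)[OF d]
      drazin_inv_bicommutant by blast
  then have "a * a * (d * d) * b = b * (a * a * (d * d))"
    using weak_commute_square(1)[OF assms(2,3)] by (metis mult.assoc)
  then show ?thesis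
    unfolding drazin_inv_square(2)[OF d] .
qed

text \<open>On the corner of \<open>q = 1 - p\<close> the square of \<open>a + b\<close> is \<open>b\<^sup>2\<close> plus the sum of the nilpotents \<open>a\<^sup>2\<close>,
\<open>ab\<close> and \<open>ba\<close>, and these four elements commute pairwise.  The idempotent is arbitrary, not
the one that belongs to \<open>a\<close>, so that the lemma also applies to a pair that has already been cut
down to a corner.\<close>

lemma drazin_add_iff_idempotent:
  fixes a b c c' p :: "'r::{ring, monoid_mult}"
  assumes b: "drazin b"
    and ac: "a * b = c * a" "b * a = a * c"
    and bc: "b * a = c' * b" "a * b = b * c'"
    and p: "p * p = p" "p * a = a * p" "p * b = b * p"
    and nil: "nilpotent ((1 - p) * a)"
  shows "drazin (a + b) \<longleftrightarrow> drazin (p * (a + b))"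
proof -
  define q where "q = 1 - p"
  have q: "q * q = q" "q * a = a * q" "q * b = b * q"
    using p by (simp_all add: q_def algebra_simps)
  obtain n where n: "q * a ^ Suc n = 0"
    using nil unfolding nilpotent_def q_def[symmetric]
    by (metis mult_zero_right power_Suc power_idempotent_mult[OF q(1,2)])
  have sq: "a * a * b = b * (a * a)" "b * b * a = a * (b * b)"
    using weak_commute_square(1)[OF ac] weak_commute_square(1)[OF bc] .
  have ab: "nilpotent (q * (a * b))"
  proof -
    have "a * a * (c * b) = c * b * (a * a)"
      using sq(1) weak_commute_square(2)[OF ac] by (metis mult.assoc)
    then have "(a * b * (a * b)) ^ Suc n = (a * a) ^ Suc n * (c * b) ^ Suc n"
      unfolding weak_commute_square(3)[OF ac] by (rule power_mult_commuting)
    moreover have "q * (a * a) ^ Suc n = 0"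
      using n by (metis mult.assoc mult_zero_left power_mult_commuting)
    ultimately have z: "q * (a * b * (a * b)) ^ Suc n = 0"
      by (metis mult.assoc mult_zero_left)
    have "q * (a * b * (a * b)) = a * b * (a * b) * q"
      using q by (metis mult.assoc)
    then have "(q * (a * b * (a * b))) ^ Suc n = 0"
      using z power_idempotent_mult[OF q(1)] by metis
    moreover have "q * (a * b * (a * b)) = (q * (a * b)) ^ 2"
      unfolding power2_eq_square using q by (metis mult.assoc)
    ultimately show ?thesis
      unfolding nilpotent_def by (metis power_mult)
  qed
  \<comment> \<open>\<open>(ba)\<^sup>m\<^sup>+\<^sup>1 = b(ab)\<^sup>ma\<close>\<close>
  have ba: "nilpotent (q * (b * a))"
  proof -
    obtain m where m: "(q * (a * b)) ^ m = 0"
      using ab unfolding nilpotent_def by blast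
    have "(q * (b * a)) ^ k * b = b * (q * (a * b)) ^ k" for k
      by (induction k) (simp_all, metis mult.assoc q(3))
    then have "(q * (b * a)) ^ Suc m = 0"
      using m by (metis mult.assoc mult_zero_left mult_zero_right power_Suc2 q(3))
    then show ?thesis unfolding nilpotent_def by blast
  qed
  have aa: "nilpotent (q * (a * a))"
  proof -
    have "q * (a * a) = q * a * (q * a)"
      using q by (metis mult.assoc)
    then show ?thesis
      using nilpotent_mult[OF nil] unfolding q_def by simp
  qed
  have comm: "q * x * (q * y) = q * y * (q * x)"
    if "x * y = y * x" "q * x = x * q" "q * y = y * q" for x y
    using that q(1) by (metis mult.assoc)
  have qs: "q * (a * a) = a * a * q" "q * (b * b) = b * b * q"
    "q * (a * b) = a * b * q" "q * (b * a) = b * a * q"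
    using q by (metis mult.assoc)+
  have "a * b * (b * a) = b * a * (a * b)"
    using sq by (metis mult.assoc)
  then have "nilpotent (q * (a * b + b * a))"
    unfolding distrib_left using ab ba comm qs by (intro nilpotent_add) auto
  moreover have "a * a * (a * b + b * a) = (a * b + b * a) * (a * a)"
    unfolding distrib_left distrib_right using sq by (metis mult.assoc)
  ultimately have "nilpotent (q * (a * a + (a * b + b * a)))"
    unfolding distrib_left[of q "a * a"] using aa qs
    by (intro nilpotent_add comm) (auto simp: distrib_left distrib_right)
  moreover have "drazin (q * (b * b))"
    using b q qs by (intro drazin_idempotent_mult drazin_square_iff[THEN iffD2])
  moreover have "b * b * (a * a + (a * b + b * a)) = (a * a + (a * b + b * a)) * (b * b)"
    unfolding distrib_left distrib_right using sq by (metis mult.assoc)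
  ultimately have "drazin (q * (b * b) + q * (a * a + (a * b + b * a)))"
    using qs by (intro drazin_add_nilpotent comm) (auto simp: distrib_left distrib_right)
  moreover have "q * (a + b) = (a + b) * q"
    using q by (simp add: distrib_left distrib_right)
  then have "q * (a + b) * (q * (a + b)) = q * ((a + b) * (a + b))"
    using q(1) by (metis mult.assoc)
  moreover have "\<dots> = q * (b * b) + q * (a * a + (a * b + b * a))"
    by (simp add: algebra_simps)
  ultimately have "drazin (q * (a + b))"
    using drazin_square_iff by metis
  moreover have "p * (a + b) = (a + b) * p"
    using p by (simp add: algebra_simps)
  ultimately show ?thesis
    using drazin_split[OF p(1)] unfolding q_def by blast
qed

theorem drazin_add_equivalences:
  fixes a b :: "'r::{ring, monoid_mult}"
  assumes a: "drazin_inv a d" and b: "drazin_inv b e"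
    and ac: "a * b = c * a" "b * a = a * c"
    and bc: "b * a = c' * b" "a * b = b * c'"
  shows "drazin (a + b) \<longleftrightarrow> drazin (a * d * (a + b) * (b * e))"
    and "drazin (a + b) \<longleftrightarrow> drazin (a * d * (a + b))"
    and "drazin (a + b) \<longleftrightarrow> drazin ((a + b) * (b * e))"
proof -
  define p q where "p = a * d" and "q = b * e"
  have p: "p * p = p" "p * a = a * p" "p * b = b * p"
    unfolding p_def using drazin_inv_idempotent[OF a] weak_commute_drazin_idempotent[OF a ac] by auto
  have q: "q * q = q" "q * b = b * q" "q * a = a * q"
    unfolding q_def using drazin_inv_idempotent[OF b] weak_commute_drazin_idempotent[OF b bc] by auto
  have dr: "drazin a" "drazin b"
    using a b unfolding drazin_def by blast+
  have "(1 - p) * a = a * (1 - p)" "(1 - q) * b = b * (1 - q)"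
    using p q by (simp_all only: left_diff_distrib right_diff_distrib mult_1_left mult_1_right)
  then have nil: "nilpotent ((1 - p) * a)" "nilpotent ((1 - q) * b)"
    using a b unfolding drazin_inv_def p_def q_def by metis+
  then show iii: "drazin (a + b) \<longleftrightarrow> drazin (a * d * (a + b))"
    unfolding p_def[symmetric] using drazin_add_iff_idempotent[OF dr(2) ac bc p] by blast
  have "drazin (b + a) \<longleftrightarrow> drazin (q * (b + a))"
    using drazin_add_iff_idempotent[OF dr(1) bc ac q nil(2)] .
  moreover have "q * (b + a) = (a + b) * q"
    using q by (simp add: algebra_simps)
  ultimately show "drazin (a + b) \<longleftrightarrow> drazin ((a + b) * (b * e))"
    unfolding q_def[symmetric] by (simp add: add.commute)
  have pq: "q * p = p * q"
    unfolding p_def using drazin_inv_bicommutant[OF a q(3)[symmetric]] q(3) by (metis mult.assoc)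
  \<comment> \<open>Cutting down by \<open>q\<close> after \<open>p\<close>: the pair \<open>(pb, pa)\<close> is weakly commuting again, with
    multipliers \<open>pc'\<close> and \<open>pc\<close>.\<close>
  have "drazin (p * b + p * a) \<longleftrightarrow> drazin (q * (p * b + p * a))"
  proof (rule drazin_add_iff_idempotent)
    show "drazin (p * a)" using dr p by (intro drazin_idempotent_mult)
    show "p * b * (p * a) = (p * c') * (p * b)" using p bc by (metis mult.assoc)
    show "p * a * (p * b) = p * b * (p * c')" using p bc by (metis mult.assoc)
    show "p * a * (p * b) = (p * c) * (p * a)" using p ac by (metis mult.assoc)
    show "p * b * (p * a) = p * a * (p * c)" using p ac by (metis mult.assoc)
    show "q * q = q" by fact
    show "q * (p * b) = p * b * q" "q * (p * a) = p * a * q" using pq q by (metis mult.assoc)+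
    have "(1 - q) * b * p = p * ((1 - q) * b)"
      using p pq by (simp add: left_diff_distrib right_diff_distrib) (metis mult.assoc)
    moreover have "(1 - q) * (p * b) = (1 - q) * b * p" using p by (simp add: mult.assoc)
    ultimately show "nilpotent ((1 - q) * (p * b))"
      using nilpotent_mult[OF nil(2)] by metis
  qed
  moreover have "p * b + p * a = p * (a + b)" by (simp add: algebra_simps)
  moreover have "q * (a + b) = (a + b) * q"
    using q by (simp add: distrib_left distrib_right)
  then have "q * (p * (a + b)) = p * (a + b) * q"
    using pq by (metis mult.assoc)
  ultimately show "drazin (a + b) \<longleftrightarrow> drazin (a * d * (a + b) * (b * e))"
    using iii unfolding p_def[symmetric] q_def[symmetric] by metis
qed


section \<open>The ring of bounded complex-linear operators\<close>

lemma scaleC_zero_right: "c *\<^sub>C (0::'a::complex_banach) = 0"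
  using norm_scaleC[of c "0::'a"] by simp

lemma scaleC_minus_right: "c *\<^sub>C (- x) = - (c *\<^sub>C (x::'a::complex_banach))"
  using scaleC_add_right[of c x "- x"] by (simp add: scaleC_zero_right add_eq_0_iff)

lemma scaleC_diff_right: "c *\<^sub>C (x - y) = c *\<^sub>C x - c *\<^sub>C (y::'a::complex_banach)"
  using scaleC_add_right[of c x "- y"] by (simp add: scaleC_minus_right)

lemma bounded_ops_closed:
  "id_blinfun \<in> bounded_ops" "0 \<in> bounded_ops"
  "S \<in> bounded_ops \<Longrightarrow> T \<in> bounded_ops \<Longrightarrow> S + T \<in> bounded_ops"
  "S \<in> bounded_ops \<Longrightarrow> T \<in> bounded_ops \<Longrightarrow> S - T \<in> bounded_ops"
  "S \<in> bounded_ops \<Longrightarrow> - S \<in> bounded_ops"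
  "S \<in> bounded_ops \<Longrightarrow> T \<in> bounded_ops \<Longrightarrow> S o\<^sub>L T \<in> bounded_ops"
  unfolding bounded_ops_def
  by (auto simp: blinfun.bilinear_simps scaleC_zero_right scaleC_minus_right scaleC_diff_right
      scaleC_add_right)

text \<open>The operators are made into a type of their own so that the ring results apply to them; it is also
what confines inverses and multipliers to complex-linear operators.\<close>

typedef (overloaded) 'a bounded_op = "bounded_ops :: ('a::complex_banach \<Rightarrow>\<^sub>L 'a) set"
  using bounded_ops_closed(1) by blast

instantiation bounded_op :: (complex_banach) "{ring, monoid_mult}"
begin

definition "0 = Abs_bounded_op 0"
definition "1 = Abs_bounded_op id_blinfun"
definition "S + T = Abs_bounded_op (Rep_bounded_op S + Rep_bounded_op T)"
definition "S - T = Abs_bounded_op (Rep_bounded_op S - Rep_bounded_op T)"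
definition "- S = Abs_bounded_op (- Rep_bounded_op S)"
definition "S * T = Abs_bounded_op (Rep_bounded_op S o\<^sub>L Rep_bounded_op T)"

lemma Rep_bounded_op_simps:
  "Rep_bounded_op 0 = 0"
  "Rep_bounded_op 1 = id_blinfun"
  "Rep_bounded_op (S + T) = Rep_bounded_op S + Rep_bounded_op T"
  "Rep_bounded_op (S - T) = Rep_bounded_op S - Rep_bounded_op T"
  "Rep_bounded_op (- S) = - Rep_bounded_op S"
  "Rep_bounded_op (S * T) = Rep_bounded_op S o\<^sub>L Rep_bounded_op T"
  unfolding zero_bounded_op_def one_bounded_op_def plus_bounded_op_def minus_bounded_op_def
    uminus_bounded_op_def times_bounded_op_def
  by (simp_all add: Abs_bounded_op_inverse Rep_bounded_op bounded_ops_closed)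

instance
  by standard
    (simp_all add: Rep_bounded_op_inject[symmetric] Rep_bounded_op_simps blinfun_eq_iff
      blinfun.bilinear_simps algebra_simps)

end

lemma Rep_bounded_op_power: "Rep_bounded_op (T ^ n) = op_power (Rep_bounded_op T) n"
  by (induction n) (simp_all add: Rep_bounded_op_simps)

lemma nilpotent_op_Rep: "nilpotent_op (Rep_bounded_op T) \<longleftrightarrow> nilpotent T"
  unfolding nilpotent_op_def nilpotent_def
  by (metis Rep_bounded_op_inject Rep_bounded_op_power Rep_bounded_op_simps(1))

lemma is_drazin_inverse_Rep:
  "is_drazin_inverse (Rep_bounded_op T) (Rep_bounded_op D) \<longleftrightarrow> drazin_inv T D"
  unfolding is_drazin_inverse_def drazin_inv_def nilpotent_op_Rep[symmetric]
  by (simp add: Rep_bounded_op Rep_bounded_op_simps flip: Rep_bounded_op_inject)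

lemma drazin_invertible_ops_Rep: "Rep_bounded_op T \<in> drazin_invertible_ops \<longleftrightarrow> drazin T"
proof -
  have "(\<exists>D. is_drazin_inverse (Rep_bounded_op T) D) \<longleftrightarrow>
      (\<exists>D. is_drazin_inverse (Rep_bounded_op T) (Rep_bounded_op D))"
    using Abs_bounded_op_inverse unfolding is_drazin_inverse_def by metis
  then show ?thesis
    unfolding drazin_invertible_ops_def drazin_def is_drazin_inverse_Rep
    by (simp add: Rep_bounded_op)
qed

lemma drazin_invertible_opsE:
  assumes "A \<in> drazin_invertible_ops"
  obtains a d where "A = Rep_bounded_op a" and "A\<^sup>D = Rep_bounded_op d" and "drazin_inv a d"
proof -
  have D: "is_drazin_inverse A (A\<^sup>D)"
    using assms by (rule is_drazin_inverse_drazin_inverse)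
  moreover obtain a d where "A = Rep_bounded_op a" "A\<^sup>D = Rep_bounded_op d"
    using assms D unfolding drazin_invertible_ops_def is_drazin_inverse_def
    by (metis (no_types, lifting) Abs_bounded_op_inverse mem_Collect_eq)
  ultimately show ?thesis
    using that is_drazin_inverse_Rep by metis
qed

lemma first_weakly_commutative_Rep:
  "first_weakly_commutative (Rep_bounded_op a) (Rep_bounded_op b) \<longleftrightarrow>
    (\<exists>c. a * b = c * a \<and> b * a = a * c)"
proof -
  have "first_weakly_commutative (Rep_bounded_op a) (Rep_bounded_op b) \<longleftrightarrow>
    (\<exists>c. Rep_bounded_op (a * b) = Rep_bounded_op (c * a) \<and>
      Rep_bounded_op (b * a) = Rep_bounded_op (a * c))"
    unfolding first_weakly_commutative_def Rep_bounded_op_simps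
    by (metis Abs_bounded_op_inverse Rep_bounded_op)
  then show ?thesis unfolding Rep_bounded_op_inject .
qed


section \<open>Sums of weakly commuting Drazin invertible operators\<close>

theorem theorem2p10:
  fixes A B :: "'a::complex_banach \<Rightarrow>\<^sub>L 'a"
  assumes "A \<in> drazin_invertible_ops" and "B \<in> drazin_invertible_ops"
    and "weakly_commutative A B"
  shows "(A + B \<in> drazin_invertible_ops
            \<longleftrightarrow> A o\<^sub>L A\<^sup>D o\<^sub>L (A + B) o\<^sub>L B o\<^sub>L B\<^sup>D \<in> drazin_invertible_ops)
       \<and> (A + B \<in> drazin_invertible_ops
            \<longleftrightarrow> A o\<^sub>L A\<^sup>D o\<^sub>L (A + B) \<in> drazin_invertible_ops)
       \<and> (A + B \<in> drazin_invertible_ops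
            \<longleftrightarrow> (A + B) o\<^sub>L B o\<^sub>L B\<^sup>D \<in> drazin_invertible_ops)"
proof -
  obtain a d where a: "A = Rep_bounded_op a" "A\<^sup>D = Rep_bounded_op d" "drazin_inv a d"
    using assms(1) by (rule drazin_invertible_opsE)
  obtain b e where b: "B = Rep_bounded_op b" "B\<^sup>D = Rep_bounded_op e" "drazin_inv b e"
    using assms(2) by (rule drazin_invertible_opsE)
  obtain c c' where "a * b = c * a" "b * a = a * c" "b * a = c' * b" "a * b = b * c'"
    using assms(3) unfolding weakly_commutative_def a(1) b(1) first_weakly_commutative_Rep
    by blast
  note equivalences = drazin_add_equivalences[OF a(3) b(3) this]
  show ?thesis
    unfolding a(2) b(2)
    unfolding a(1) b(1) Rep_bounded_op_simps(3,6)[symmetric] drazin_invertible_ops_Rep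
    using equivalences unfolding mult.assoc by blast
qed

end
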